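(* Let $G$ be a finite bipartite graph with bipartition $U\uplus V$. Then $$\mathrm{jk}(G)\;\le\;\mathrm{fool}(G)\;\le\;\mathrm{fool}^\infty(G)\;\le\;\min_{Q}\,(\operatorname{rk} Q)^2,$$ where the minimum extends over all fields $\mathbb{k}$ and all $(U\times V)$-matrices $Q$ over $\mathbb{k}$ such that, for all $u\in U$ and $v\in V$, $$Q_{uv}\neq 0\quad\text{if and only if}\quad uv\in E(G),$$ and $\operatorname{rk} Q$ is the rank of $Q$ over $\mathbb{k}$.
   Context: Graphs are finite and simple. For a graph $H$, $|H|$ denotes its number of vertices and $\|H\|$ its number of edges. Bipartite graphs with a fixed bipartition $U\uplus V$ are identified with 01-matrices via the bipartite adjacency matrix $M=M(G)$: rows are indexed by $U$, columns by $V$, and $M_{uv}=1$ if $uv\in E(G)$, $M_{uv}=0$ otherwise. Thus a graph parameter may be applied to a 01-matrix. Fooling set: a set $F\subseteq E(G)$ such that no two distinct edges in $F$ induce a complete bipartite graph; that is, any two distinct edges of $F$ are not incident and are not contained together in a cycle of length four of $G$. $\mathrm{fool}(G)$ is the maximum cardinality of a fooling set in $G$. $M^{\otimes j}$ is the $j$-th tensor (Kronecker) power of $M$: the 01-matrix with rows indexed by $U^j$, columns indexed by $V^j$ and entries $(M^{\otimes j})_{uv}=\prod_{i=1}^j M_{u_iv_i}$. Define $$\mathrm{fool}^\infty(G)=\mathrm{fool}^\infty(M):=\limsup_{j\to\infty}\ \mathrm{fool}(M^{\otimes j})^{1/j}.$$ $\mathrm{jk}(G)$ is the maximum of $\dfrac{|H|^2}{4\|H\|}$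 over all nonempty induced subgraphs $H$ of $G$ that have a perfect matching (with $\mathrm{jk}(G)=0$ if $G$ has no edges, i.e. if no such $H$ exists). *)

theory Defs
  imports
    Complex_Main
    "HOL-Library.Extended_Real"
    "HOL-Library.Liminf_Limsup"
    "HOL-Library.Function_Algebras"
begin

section \<open>Finite simple graphs and bipartite graphs\<close>

record 'a sgraph =
  verts :: "'a set"
  edges :: "'a set set"

definition simple_graph :: "'a sgraph \<Rightarrow> bool" where
  "simple_graph G \<longleftrightarrow> finite (verts G) \<and> (\<forall>e\<in>edges G. e \<subseteq> verts G \<and> card e = 2)"

definition bipartite_graph :: "'a sgraph \<Rightarrow> 'a set \<Rightarrow> 'a set \<Rightarrow> bool" where
  "bipartite_graph G U V \<longleftrightarrow> simple_graph G \<and> verts G = U \<union> V \<and> U \<inter> V = {} \<and>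
     (\<forall>e\<in>edges G. \<exists>u\<in>U. \<exists>v\<in>V. e = {u, v})"

definition induced :: "'a sgraph \<Rightarrow> 'a set \<Rightarrow> 'a sgraph" where
  "induced G W = \<lparr>verts = W, edges = {e \<in> edges G. e \<subseteq> W}\<rparr>"

definition complete_bipartite :: "'a sgraph \<Rightarrow> bool" where
  "complete_bipartite H \<longleftrightarrow>
     (\<exists>A B. A \<inter> B = {} \<and> verts H = A \<union> B \<and> edges H = {{a, b} | a b. a \<in> A \<and> b \<in> B})"

definition has_perfect_matching :: "'a sgraph \<Rightarrow> bool" where
  "has_perfect_matching H \<longleftrightarrow> (\<exists>M \<subseteq> edges H. \<forall>v\<in>verts H. \<exists>!e. e \<in> M \<and> v \<in> e)"

section \<open>Fooling sets and the parameter jk\<close>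

definition fooling_set :: "'a sgraph \<Rightarrow> 'a set set \<Rightarrow> bool" where
  "fooling_set G F \<longleftrightarrow> F \<subseteq> edges G \<and>
     (\<forall>e\<in>F. \<forall>f\<in>F. e \<noteq> f \<longrightarrow> \<not> complete_bipartite (induced G (e \<union> f)))"

definition fool :: "'a sgraph \<Rightarrow> nat" where
  "fool G = Max {card F | F. fooling_set G F}"

definition jk :: "'a sgraph \<Rightarrow> real" where
  "jk G =
     (let \<W> = {W. W \<subseteq> verts G \<and> W \<noteq> {} \<and> has_perfect_matching (induced G W)}
      in if \<W> = {} then 0
         else Max ((\<lambda>W. real ((card (verts (induced G W)))\<^sup>2)
                        / (4 * real (card (edges (induced G W))))) ` \<W>))"

section \<open>Bipartite graphs as 01-matrices, and the asymptotic fooling number\<close>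

text \<open>An \<open>R \<times> C\<close> matrix is a function of two arguments together with its finite index sets
  \<open>R\<close> and \<open>C\<close>; only the values on \<open>R \<times> C\<close> are used.\<close>

definition adj_matrix :: "'a sgraph \<Rightarrow> 'a \<Rightarrow> 'a \<Rightarrow> nat" where
  "adj_matrix G u v = (if {u, v} \<in> edges G then 1 else 0)"

definition graph_of_matrix :: "'r set \<Rightarrow> 'c set \<Rightarrow> ('r \<Rightarrow> 'c \<Rightarrow> nat) \<Rightarrow> ('r + 'c) sgraph" where
  "graph_of_matrix R C M =
     \<lparr>verts = R <+> C, edges = {{Inl r, Inr c} | r c. r \<in> R \<and> c \<in> C \<and> M r c = 1}\<rparr>"

definition tuples :: "nat \<Rightarrow> 'a set \<Rightarrow> 'a list set" where
  "tuples j S = {xs. length xs = j \<and> set xs \<subseteq> S}"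

definition tensor_power :: "nat \<Rightarrow> ('r \<Rightarrow> 'c \<Rightarrow> nat) \<Rightarrow> 'r list \<Rightarrow> 'c list \<Rightarrow> nat" where
  "tensor_power j M us vs = (\<Prod>i<j. M (us ! i) (vs ! i))"

definition fool_inf_matrix :: "'r set \<Rightarrow> 'c set \<Rightarrow> ('r \<Rightarrow> 'c \<Rightarrow> nat) \<Rightarrow> ereal" where
  "fool_inf_matrix R C M =
     limsup (\<lambda>j. ereal (root j (real (fool
       (graph_of_matrix (tuples j R) (tuples j C) (tensor_power j M))))))"

definition fool_inf :: "'a sgraph \<Rightarrow> 'a set \<Rightarrow> 'a set \<Rightarrow> ereal" where
  "fool_inf G U V = fool_inf_matrix U V (adj_matrix G)"

section \<open>Matrices over fields\<close>

text \<open>The rank is the dimension of the row space; rows are extended by zero outside \<open>C\<close>.\<close>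

definition fun_scale :: "'k::field \<Rightarrow> ('c \<Rightarrow> 'k) \<Rightarrow> 'c \<Rightarrow> 'k" where
  "fun_scale a f = (\<lambda>c. a * f c)"

lemma vector_space_fun_scale: "vector_space fun_scale"
  by unfold_locales (auto simp: fun_scale_def fun_eq_iff algebra_simps)

definition matrix_rank :: "'r set \<Rightarrow> 'c set \<Rightarrow> ('r \<Rightarrow> 'c \<Rightarrow> 'k::field) \<Rightarrow> nat" where
  "matrix_rank R C Q =
     vector_space.dim fun_scale ((\<lambda>r c. if c \<in> C then Q r c else 0) ` R)"

definition has_support_of ::
  "('a \<Rightarrow> 'a \<Rightarrow> 'k::field) \<Rightarrow> 'a sgraph \<Rightarrow> 'a set \<Rightarrow> 'a set \<Rightarrow> bool" where
  "has_support_of Q G U V \<longleftrightarrow> (\<forall>u\<in>U. \<forall>v\<in>V. Q u v \<noteq> 0 \<longleftrightarrow> {u, v} \<in> edges G)"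

text \<open>Over every field there is such a matrix, so the least squared rank is a genuine minimum.\<close>

lemma has_support_of_adj_matrix:
  "has_support_of (\<lambda>u v. of_nat (adj_matrix G u v)) G U V"
  by (simp add: has_support_of_def adj_matrix_def)

section \<open>Concrete descriptions of fooling sets in bipartite graphs\<close>

lemma complete_bipartite_induced_iff:
  assumes G: "bipartite_graph G U V"
    and u: "u \<in> U" and v: "v \<in> V" and x: "x \<in> U" and y: "y \<in> V"
    and uv: "{u, v} \<in> edges G" and xy: "{x, y} \<in> edges G"
  shows "complete_bipartite (induced G ({u, v} \<union> {x, y})) \<longleftrightarrow>
           {u, y} \<in> edges G \<and> {x, v} \<in> edges G"
proof
  have disj: "U \<inter> V = {}" and
    E: "\<And>e. e \<in> edges G \<Longrightarrow> \<exists>a\<in>U. \<exists>b\<in>V. e = {a, b}"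
    using G by (auto simp: bipartite_graph_def)
  have UU: "{a, b} \<notin> edges G" if "a \<in> U" "b \<in> U" for a b
    using E[of "{a, b}"] that disj by (auto simp: doubleton_eq_iff)
  {
    assume "complete_bipartite (induced G ({u, v} \<union> {x, y}))"
    then obtain A B where vs: "{u, v} \<union> {x, y} = A \<union> B" and AB: "A \<inter> B = {}"
      and es: "{e \<in> edges G. e \<subseteq> {u, v} \<union> {x, y}} = {{a, b} | a b. a \<in> A \<and> b \<in> B}"
      unfolding complete_bipartite_def induced_def sgraph.select_convs by (elim exE conjE) (rule that)
    have in_E: "{a, b} \<in> edges G" if "a \<in> A" "b \<in> B" for a b
    proof -
      have "{a, b} \<in> {{a, b} | a b. a \<in> A \<and> b \<in> B}" using that by blast
      then show ?thesis unfolding es[symmetric] by simp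
    qed
    have side: "(p \<in> A \<and> q \<in> B) \<or> (q \<in> A \<and> p \<in> B)"
      if "{p, q} \<in> edges G" "{p, q} \<subseteq> {u, v} \<union> {x, y}" for p q
    proof -
      have "{p, q} \<in> {{a, b} | a b. a \<in> A \<and> b \<in> B}"
        unfolding es[symmetric] using that by simp
      then show ?thesis by (auto simp: doubleton_eq_iff)
    qed
    have 1: "(u \<in> A \<and> v \<in> B) \<or> (v \<in> A \<and> u \<in> B)" using side[OF uv] by auto
    have 2: "(x \<in> A \<and> y \<in> B) \<or> (y \<in> A \<and> x \<in> B)" using side[OF xy] by auto
    show "{u, y} \<in> edges G \<and> {x, v} \<in> edges G"
      using 1 2 in_E UU[OF u x] UU[OF x u] by (metis insert_commute)
  }
  {
    assume uyxv: "{u, y} \<in> edges G \<and> {x, v} \<in> edges G"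
    have "{e \<in> edges G. e \<subseteq> {u, v} \<union> {x, y}} = {{a, b} | a b. a \<in> {u, x} \<and> b \<in> {v, y}}"
    proof (intro equalityI subsetI)
      fix e assume "e \<in> {e \<in> edges G. e \<subseteq> {u, v} \<union> {x, y}}"
      then obtain a b where ab: "a \<in> U" "b \<in> V" "e = {a, b}" "{a, b} \<subseteq> {u, v} \<union> {x, y}"
        using E by blast
      then have "a \<in> {u, x}" "b \<in> {v, y}" using disj u v x y by auto
      then show "e \<in> {{a, b} | a b. a \<in> {u, x} \<and> b \<in> {v, y}}" using ab by blast
    next
      fix e assume "e \<in> {{a, b} | a b. a \<in> {u, x} \<and> b \<in> {v, y}}"
      then show "e \<in> {e \<in> edges G. e \<subseteq> {u, v} \<union> {x, y}}" using uv xy uyxv by auto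
    qed
    moreover have "{u, x} \<inter> {v, y} = {}" "{u, v} \<union> {x, y} = {u, x} \<union> {v, y}"
      using disj u v x y by auto
    ultimately show "complete_bipartite (induced G ({u, v} \<union> {x, y}))"
      unfolding complete_bipartite_def induced_def sgraph.select_convs
      by (intro exI[of _ "{u, x}"] exI[of _ "{v, y}"] conjI)
  }
qed

lemma fooling_set_iff_no_4_cycle:
  assumes G: "bipartite_graph G U V"
  shows "fooling_set G F \<longleftrightarrow> F \<subseteq> edges G \<and>
    (\<forall>e\<in>F. \<forall>f\<in>F. e \<noteq> f \<longrightarrow> e \<inter> f = {} \<and>
      \<not> (\<exists>a b c d. distinct [a, b, c, d] \<and>
           {{a, b}, {b, c}, {c, d}, {d, a}} \<subseteq> edges G \<and>
           {e, f} \<subseteq> {{a, b}, {b, c}, {c, d}, {d, a}}))"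
proof -
  have disj: "U \<inter> V = {}" and
    E: "\<And>e. e \<in> edges G \<Longrightarrow> \<exists>a\<in>U. \<exists>b\<in>V. e = {a, b}"
    using G by (auto simp: bipartite_graph_def)
  have UU: "{a, b} \<notin> edges G" if "a \<in> U" "b \<in> U" for a b
    using E[of "{a, b}"] that disj by (auto simp: doubleton_eq_iff)
  have key: "complete_bipartite (induced G (e \<union> f)) \<longleftrightarrow> \<not> (e \<inter> f = {} \<and>
      \<not> (\<exists>a b c d. distinct [a, b, c, d] \<and>
           {{a, b}, {b, c}, {c, d}, {d, a}} \<subseteq> edges G \<and>
           {e, f} \<subseteq> {{a, b}, {b, c}, {c, d}, {d, a}}))"
    (is "?L \<longleftrightarrow> \<not> (_ \<and> \<not> ?C)")
    if e: "e \<in> edges G" and f: "f \<in> edges G" and ne: "e \<noteq> f" for e f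
  proof -
    obtain u v where uv: "u \<in> U" "v \<in> V" "e = {u, v}" using E[OF e] by blast
    obtain x y where xy: "x \<in> U" "y \<in> V" "f = {x, y}" using E[OF f] by blast
    have L: "?L \<longleftrightarrow> {u, y} \<in> edges G \<and> {x, v} \<in> edges G"
      using complete_bipartite_induced_iff[OF G uv(1,2) xy(1,2)] uv(3) xy(3) e f by simp
    have ux: "u \<noteq> v" "u \<noteq> y" "x \<noteq> v" "x \<noteq> y" using disj uv xy by auto
    show ?thesis
    proof (cases "e \<inter> f = {}")
      case False
      then have "u = x \<or> v = y" using ux uv xy by auto
      then show ?thesis using False L e f uv xy by auto
    next
      case True
      then have d: "u \<noteq> x" "v \<noteq> y" using uv xy by auto
      have "?C" if ?L
      proof -
        have "distinct [u, v, x, y]" using ux d by auto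
        moreover have "{{u, v}, {v, x}, {x, y}, {y, u}} \<subseteq> edges G"
          using that L e f uv(3) xy(3) by (simp add: insert_commute)
        moreover have "{e, f} \<subseteq> {{u, v}, {v, x}, {x, y}, {y, u}}"
          using uv(3) xy(3) by simp
        ultimately show ?thesis by blast
      qed
      moreover have "?L" if ?C
        using that
      proof (elim exE conjE)
        fix a b c d
        assume cyc: "{{a, b}, {b, c}, {c, d}, {d, a}} \<subseteq> edges G"
          and ef: "{e, f} \<subseteq> {{a, b}, {b, c}, {c, d}, {d, a}}"
        have "e = {a, b} \<or> e = {b, c} \<or> e = {c, d} \<or> e = {d, a}"
          "f = {a, b} \<or> f = {b, c} \<or> f = {c, d} \<or> f = {d, a}"
          using ef by simp_all
        then have opp: "(e = {a, b} \<and> f = {c, d}) \<or> (e = {c, d} \<and> f = {a, b}) \<or>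
              (e = {b, c} \<and> f = {d, a}) \<or> (e = {d, a} \<and> f = {b, c})"
          by (elim disjE) (use True in simp_all)
        have sw: "{u, y} \<in> edges G \<and> {x, v} \<in> edges G"
          if "e = {p, q}" "f = {r, s}" "{q, r} \<in> edges G" "{s, p} \<in> edges G" for p q r s
        proof -
          have "p = u \<and> q = v \<or> p = v \<and> q = u" "r = x \<and> s = y \<or> r = y \<and> s = x"
            using that(1,2) uv(3) xy(3) by (simp_all add: doubleton_eq_iff) blast+
          then show ?thesis
            by (elim disjE)
              (use that(3,4) UU[OF uv(1) xy(1)] UU[OF xy(1) uv(1)]
                in \<open>simp_all add: insert_commute\<close>)
        qed
        have "{u, y} \<in> edges G \<and> {x, v} \<in> edges G"
          using opp
          by (elim disjE conjE) ((erule (1) sw), (use cyc in simp), (use cyc in simp))+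
        then show ?L using L by simp
      qed
      ultimately have "?L \<longleftrightarrow> ?C" by (rule iffI)
      then show ?thesis by (simp only: True simp_thms not_not)
    qed
  qed
  show ?thesis
    unfolding fooling_set_def
    by (intro conj_cong refl ball_cong imp_cong, subst key) (blast, blast, assumption, rule not_not)
qed

end

theory Submission
  imports Defs "HOL-Library.FuncSet"
begin

text \<open>
  The three inequalities have independent proofs, all phrased for a fooling set given as a set
  of (row, column) pairs.

  \<^emph>\<open>jk is at most fool.\<close> Let an induced subgraph with \<open>m\<close> edges have a perfect matching of
  \<open>n\<close> edges \<open>u\<^sub>p v\<^sub>p\<close>. Call \<open>p\<close> and \<open>q\<close> in conflict if both \<open>u\<^sub>p v\<^sub>q\<close> and
  \<open>u\<^sub>q v\<^sub>p\<close> are edges. A set of matching edges without conflicts between distinct members is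
  a fooling set. The map \<open>(p, q) \<mapsto> u\<^sub>p v\<^sub>q\<close> sends ordered conflicting pairs, including
  the pairs \<open>(p, p)\<close>, injectively to edges, so there are at most \<open>m\<close> of them. By the
  Caro--Wei bound and convexity there is a conflict-free set of size at least \<open>n\<^sup>2 / m\<close>, which
  is \<open>(2 n)\<^sup>2 / (4 m)\<close> (lemmas \<open>caro_wei\<close>, \<open>large_independent_set\<close>,
  \<open>perfect_matching_bound\<close>).

  \<^emph>\<open>fool is at most its asymptotic version.\<close> The \<open>j\<close>-tuples over a fooling set form a
  fooling set of the \<open>j\<close>-th tensor power, since two different tuples are already separated in
  one coordinate (lemma \<open>fooling_pairs_tensor_power\<close>).

  \<^emph>\<open>The rank bound.\<close> If \<open>F\<close> is a fooling set and \<open>Q\<close> is restricted to the rows and columns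
  met by \<open>F\<close>, then the entrywise product of \<open>Q\<close> with its transpose is diagonal without zeros
  on the diagonal, so it has rank \<open>|F|\<close>. An entrywise product of two matrices of rank \<open>r\<close>
  has rank at most \<open>r\<^sup>2\<close>. The same applies to the \<open>j\<close>-th tensor power of \<open>Q\<close>, of
  rank at most \<open>r ^ j\<close>, and the \<open>j\<close>-th root removes the exponent. Rank is handled throughout
  as the length of an expression of the entries as \<open>\<Sum>\<^sub>t a\<^sub>t(u) b\<^sub>t(v)\<close>, which
  makes the bounds for entrywise and tensor products an expansion of a product of sums (lemmas
  \<open>fooling_pairs_card_le_square\<close>, \<open>rank_factorization\<close>, \<open>fool_tensor_power_le\<close>).
\<close>

section \<open>Fooling sets as sets of index pairs\<close>

text \<open>The diagonal case \<open>p = q\<close> of the equivalence says that the pairs of \<open>P\<close> are edges.\<close>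

definition fooling_pairs :: "('r \<Rightarrow> 'c \<Rightarrow> bool) \<Rightarrow> ('r \<times> 'c) set \<Rightarrow> bool" where
  "fooling_pairs E P \<longleftrightarrow>
     (\<forall>p\<in>P. \<forall>q\<in>P. E (fst p) (snd q) \<and> E (fst q) (snd p) \<longleftrightarrow> p = q)"

lemma finite_edges:
  assumes "simple_graph G" shows "finite (edges G)"
  using assms by (intro finite_subset[of "edges G" "Pow (verts G)"]) (auto simp: simple_graph_def)

lemma finite_fooling_cards:
  assumes "simple_graph G" shows "finite {card F | F. fooling_set G F}"
proof -
  have "{card F | F. fooling_set G F} \<subseteq> card ` Pow (edges G)"
    by (auto simp: fooling_set_def)
  then show ?thesis using finite_edges[OF assms] finite_subset by blast
qed

text \<open>The index maps let the same facts serve two situations: a graph on its own vertices, where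
  both maps are the identity, and the graph of a matrix, where they are \<open>Inl\<close> and \<open>Inr\<close>.\<close>

locale indexed_bipartite =
  fixes G :: "'a sgraph" and i :: "'r \<Rightarrow> 'a" and k :: "'c \<Rightarrow> 'a" and R :: "'r set" and C :: "'c set"
  assumes bip: "bipartite_graph G (i ` R) (k ` C)"
    and inj_i: "inj_on i R" and inj_k: "inj_on k C"
begin

abbreviation edge :: "'r \<times> 'c \<Rightarrow> 'a set" where
  "edge p \<equiv> {i (fst p), k (snd p)}"

abbreviation adj :: "'r \<Rightarrow> 'c \<Rightarrow> bool" where
  "adj r c \<equiv> {i r, k c} \<in> edges G"

lemma simple: "simple_graph G"
  using bip by (simp add: bipartite_graph_def)

lemma edge_eq_iff:
  assumes "r \<in> R" "c \<in> C" "r' \<in> R" "c' \<in> C"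
  shows "{i r, k c} = {i r', k c'} \<longleftrightarrow> r = r' \<and> c = c'"
proof -
  have "i ` R \<inter> k ` C = {}" using bip by (simp add: bipartite_graph_def)
  then show ?thesis
    using assms inj_i inj_k by (auto simp: doubleton_eq_iff inj_on_eq_iff)
qed

lemma inj_edge: "inj_on edge (R \<times> C)"
  by (rule inj_onI) (auto simp: edge_eq_iff)

lemma edges_subset: "edges G \<subseteq> edge ` (R \<times> C)"
proof
  fix e assume "e \<in> edges G"
  then have "\<exists>u\<in>i ` R. \<exists>v\<in>k ` C. e = {u, v}"
    using bip by (simp add: bipartite_graph_def)
  then obtain r c where "r \<in> R" "c \<in> C" "e = {i r, k c}" by auto
  then show "e \<in> edge ` (R \<times> C)" by (intro image_eqI[of _ _ "(r, c)"]) auto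
qed

lemma fooling_set_edges_iff:
  assumes P: "P \<subseteq> R \<times> C"
  shows "fooling_set G (edge ` P) \<longleftrightarrow> fooling_pairs adj P"
proof -
  have conflict: "complete_bipartite (induced G (edge p \<union> edge q)) \<longleftrightarrow>
      adj (fst p) (snd q) \<and> adj (fst q) (snd p)"
    if "p \<in> P" "q \<in> P" "edge p \<in> edges G" "edge q \<in> edges G" for p q
    using that P complete_bipartite_induced_iff[OF bip, of "i (fst p)" "k (snd p)" "i (fst q)" "k (snd q)"]
    by fastforce
  have inj: "edge p = edge q \<longleftrightarrow> p = q" if "p \<in> P" "q \<in> P" for p q
    using inj_on_eq_iff[OF inj_edge, of p q] that P by blast
  have "fooling_set G (edge ` P) \<longleftrightarrow> (\<forall>p\<in>P. edge p \<in> edges G) \<and>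
     (\<forall>p\<in>P. \<forall>q\<in>P. p \<noteq> q \<longrightarrow> \<not> (adj (fst p) (snd q) \<and> adj (fst q) (snd p)))"
    unfolding fooling_set_def image_subset_iff ball_simps
    using conflict inj by (intro conj_cong refl ball_cong) auto
  then show ?thesis unfolding fooling_pairs_def by blast
qed

lemma card_le_fool:
  assumes P: "P \<subseteq> R \<times> C" and "fooling_pairs adj P"
  shows "card P \<le> fool G"
proof -
  have "card P = card (edge ` P)"
    by (rule card_image[symmetric, OF inj_on_subset[OF inj_edge P]])
  then have "card P \<in> {card F | F. fooling_set G F}"
    using assms(2) fooling_set_edges_iff[OF P] by blast
  then show ?thesis
    unfolding fool_def by (rule Max_ge[OF finite_fooling_cards[OF simple]])
qed

lemma fool_attained:
  obtains P where "P \<subseteq> R \<times> C" "finite P" "fooling_pairs adj P" "card P = fool G"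
proof -
  have "fooling_set G {}" by (simp add: fooling_set_def)
  then have "fool G \<in> {card F | F. fooling_set G F}"
    unfolding fool_def by (intro Max_in finite_fooling_cards[OF simple]) blast
  then obtain F where F: "fooling_set G F" "fool G = card F" by blast
  then have "F \<subseteq> edge ` (R \<times> C)" using edges_subset by (auto simp: fooling_set_def)
  then obtain P where P: "P \<subseteq> R \<times> C" "F = edge ` P" by (auto simp: subset_image_iff)
  have inj: "inj_on edge P" by (rule inj_on_subset[OF inj_edge P(1)])
  show ?thesis
  proof (rule that[OF P(1)])
    have "finite F"
      using F(1) finite_edges[OF simple] by (auto simp: fooling_set_def intro: finite_subset)
    then show "finite P" using finite_imageD[OF _ inj] P(2) by simp
    show "fooling_pairs adj P" using F(1) fooling_set_edges_iff[OF P(1)] P(2) by simp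
    show "card P = fool G" using card_image[OF inj] F(2) P(2) by simp
  qed
qed

end

section \<open>Independent sets and perfect matchings\<close>

text \<open>The Caro--Wei bound, for a reflexive relation, so that the cardinality below is a degree
  plus one. The greedy argument: pick \<open>z\<close> of least degree and delete its closed neighbourhood
  \<open>N\<close>. The deleted terms add up to at most \<open>|N| / |N| = 1\<close>, and the other terms only grow
  because degrees drop.\<close>

lemma caro_wei:
  fixes R :: "'a \<Rightarrow> 'a \<Rightarrow> bool"
  assumes "finite A" and refl: "\<And>x. x \<in> A \<Longrightarrow> R x x" and sym: "\<And>x y. R x y \<Longrightarrow> R y x"
  shows "\<exists>I\<subseteq>A. (\<forall>x\<in>I. \<forall>y\<in>I. R x y \<longrightarrow> x = y) \<and>
           (\<Sum>x\<in>A. 1 / real (card {y\<in>A. R x y})) \<le> real (card I)"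
  using assms(1,2)
proof (induction A rule: finite_psubset_induct)
  case (psubset A)
  define d where "d B x = real (card {y\<in>B. R x y})" for B x
  have d_pos: "d B x > 0" if "x \<in> B" "B \<subseteq> A" for B x
    using that psubset.prems[of x] finite_subset[OF that(2) psubset.hyps(1)]
    by (auto simp: d_def card_gt_0_iff)
  show ?case
  proof (cases "A = {}")
    case False
    then obtain z where z: "z \<in> A" "\<And>x. x \<in> A \<Longrightarrow> d A z \<le> d A x"
      using ex_min_if_finite[of "d A ` A"] psubset.hyps(1) by (fastforce simp: not_less)
    define N where "N = {y\<in>A. R z y}"
    have N: "N \<subseteq> A" "z \<in> N" "finite N"
      using z psubset.prems psubset.hyps(1) by (auto simp: N_def)
    obtain I where I: "I \<subseteq> A - N" "\<forall>x\<in>I. \<forall>y\<in>I. R x y \<longrightarrow> x = y"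
        "(\<Sum>x\<in>A - N. 1 / d (A - N) x) \<le> real (card I)"
      using psubset.IH[of "A - N"] N psubset.prems unfolding d_def by blast
    have "finite I" using I(1) psubset.hyps(1) finite_subset by blast
    have "(\<Sum>x\<in>N. 1 / d A x) \<le> (\<Sum>x\<in>N. 1 / d A z)"
      using z(2) N d_pos[OF z(1)] by (intro sum_mono divide_left_mono mult_pos_pos) (auto intro: d_pos)
    also have "\<dots> = 1"
      using d_pos[OF z(1)] by (simp add: d_def N_def)
    finally have *: "(\<Sum>x\<in>N. 1 / d A x) \<le> 1" .
    have "(\<Sum>x\<in>A - N. 1 / d A x) \<le> (\<Sum>x\<in>A - N. 1 / d (A - N) x)"
    proof (rule sum_mono)
      fix x assume x: "x \<in> A - N"
      have "d (A - N) x \<le> d A x"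
        unfolding d_def using psubset.hyps(1) by (intro of_nat_mono card_mono) auto
      then show "1 / d A x \<le> 1 / d (A - N) x"
        using x d_pos[of x "A - N"] by (intro divide_left_mono mult_pos_pos) (auto intro: d_pos)
    qed
    then have "(\<Sum>x\<in>A. 1 / d A x) \<le> 1 + real (card I)"
      using * I(3) sum.subset_diff[OF N(1) psubset.hyps(1), of "\<lambda>x. 1 / d A x"] by linarith
    also have "\<dots> = real (card (insert z I))"
      using I(1) N(2) \<open>finite I\<close> by (subst card_insert_disjoint) auto
    finally have "(\<Sum>x\<in>A. 1 / d A x) \<le> real (card (insert z I))" .
    moreover have "insert z I \<subseteq> A" using I(1) z(1) by auto
    moreover have "\<not> R z x" "\<not> R x z" if "x \<in> I" for x
      using that I(1) sym[of x z] by (auto simp: N_def)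
    then have "\<forall>x\<in>insert z I. \<forall>y\<in>insert z I. R x y \<longrightarrow> x = y"
      using I(2) by blast
    ultimately show ?thesis unfolding d_def by blast
  qed auto
qed

text \<open>Turan's bound, deduced from the Caro--Wei bound.\<close>

lemma large_independent_set:
  fixes R :: "'a \<Rightarrow> 'a \<Rightarrow> bool"
  assumes A: "finite A" and refl: "\<And>x. x \<in> A \<Longrightarrow> R x x" and sym: "\<And>x y. R x y \<Longrightarrow> R y x"
    and m: "card {(x, y). x \<in> A \<and> y \<in> A \<and> R x y} \<le> m" and "m > 0"
  obtains I where "I \<subseteq> A" "\<And>x y. x \<in> I \<Longrightarrow> y \<in> I \<Longrightarrow> R x y \<Longrightarrow> x = y"
    "(real (card A))\<^sup>2 / real m \<le> real (card I)"
proof -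
  define d where "d x = real (card {y\<in>A. R x y})" for x
  \<comment> \<open>Convexity of \<open>1 / d\<close> is used through the tangent line \<open>2 * t - t\<^sup>2 * d\<close>, which touches
    at \<open>d = 1 / t\<close>; this \<open>t\<close> is the reciprocal of the mean of \<open>d\<close> when there are exactly
    \<open>m\<close> related pairs.\<close>
  define t where "t = real (card A) / real m"
  obtain I where I: "I \<subseteq> A" "\<forall>x\<in>I. \<forall>y\<in>I. R x y \<longrightarrow> x = y" "(\<Sum>x\<in>A. 1 / d x) \<le> real (card I)"
    using caro_wei[of A R, OF A refl sym] unfolding d_def by blast
  have d_pos: "d x > 0" if "x \<in> A" for x
    using that refl[of x] A by (auto simp: d_def card_gt_0_iff)
  have "{(x, y). x \<in> A \<and> y \<in> A \<and> R x y} = Sigma A (\<lambda>x. {y\<in>A. R x y})" by auto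
  then have "(\<Sum>x\<in>A. d x) \<le> real m"
    using m A by (simp add: d_def flip: of_nat_sum)
  then have "t\<^sup>2 * (\<Sum>x\<in>A. d x) \<le> t\<^sup>2 * real m"
    by (intro mult_left_mono) auto
  moreover have "t\<^sup>2 * real m = t * real (card A)"
    using \<open>m > 0\<close> by (simp add: t_def power2_eq_square)
  moreover have "(\<Sum>x\<in>A. 2 * t - t\<^sup>2 * d x) \<le> (\<Sum>x\<in>A. 1 / d x)"
  proof (rule sum_mono)
    fix x assume "x \<in> A"
    have "0 \<le> (1 - t * d x)\<^sup>2 / d x" using d_pos[OF \<open>x \<in> A\<close>] by simp
    also have "\<dots> = 1 / d x - (2 * t - t\<^sup>2 * d x)"
      using d_pos[OF \<open>x \<in> A\<close>] by (simp add: power2_eq_square field_simps)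
    finally show "2 * t - t\<^sup>2 * d x \<le> 1 / d x" by simp
  qed
  moreover have "(\<Sum>x\<in>A. 2 * t - t\<^sup>2 * d x) = 2 * (t * real (card A)) - t\<^sup>2 * (\<Sum>x\<in>A. d x)"
    by (simp add: sum_subtractf sum_distrib_left)
  ultimately have "t * real (card A) \<le> (\<Sum>x\<in>A. 1 / d x)"
    by linarith
  then have "(real (card A))\<^sup>2 / real m \<le> real (card I)"
    using I(3) by (simp add: t_def power2_eq_square)
  then show ?thesis using that[of I] I by blast
qed

text \<open>The matching edges in \<open>W\<close> are the vertices of a conflict graph, whose independent sets are
  fooling sets.\<close>

lemma perfect_matching_bound:
  assumes G: "bipartite_graph G U V" and W: "W \<subseteq> verts G" "W \<noteq> {}"
    and pm: "has_perfect_matching (induced G W)"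
  shows "real ((card (verts (induced G W)))\<^sup>2) / (4 * real (card (edges (induced G W))))
           \<le> real (fool G)"
proof -
  interpret indexed_bipartite G "\<lambda>x. x" "\<lambda>x. x" U V
    by unfold_locales (use G in auto)
  have disj: "U \<inter> V = {}" and fin: "finite U" "finite V"
    using G by (auto simp: bipartite_graph_def simple_graph_def)
  obtain M where M0: "M \<subseteq> {e \<in> edges G. e \<subseteq> W}" "\<forall>v\<in>W. \<exists>!e. e \<in> M \<and> v \<in> e"
    using pm unfolding has_perfect_matching_def induced_def sgraph.select_convs by (elim exE conjE)
  have M: "M \<subseteq> edges G" "\<And>e. e \<in> M \<Longrightarrow> e \<subseteq> W" "\<And>v. v \<in> W \<Longrightarrow> \<exists>!e. e \<in> M \<and> v \<in> e"
    subgoal using M0(1) by auto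
    subgoal using M0(1) by auto
    subgoal using M0(2) by (rule bspec)
    done
  define P where "P = {(u, v) \<in> U \<times> V. {u, v} \<in> M}"
  define EW where "EW = edges (induced G W)"
  have P: "P \<subseteq> U \<times> V" "finite P"
    using fin by (auto simp: P_def intro: finite_subset[of _ "U \<times> V"])
  have uniq: "p = q" if "p \<in> P" "q \<in> P" "x \<in> edge p" "x \<in> edge q" for p q x
  proof -
    have M': "edge p \<in> M" "edge q \<in> M" using that by (auto simp: P_def)
    then have "edge p = edge q"
      using M(2)[OF M'(1)] M(3)[of x] that(3,4) by blast
    then show "p = q" by (rule inj_onD[OF inj_edge]) (use that P(1) in auto)
  qed
  have inj1: "inj_on fst P"
    by (rule inj_onI, erule (1) uniq[where x = "fst _"]) auto
  have inj2: "inj_on snd P"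
    by (rule inj_onI, erule (1) uniq[where x = "snd _"]) auto
  have in_W: "u \<in> W" "v \<in> W" if "(u, v) \<in> P" for u v
    using that M(2)[of "{u, v}"] by (auto simp: P_def)
  have cover: "\<exists>p\<in>P. x \<in> edge p" if x: "x \<in> W" for x
  proof -
    obtain e where e: "e \<in> M" "x \<in> e" using M(3)[OF x] by blast
    then obtain p where "p \<in> U \<times> V" "e = edge p" using M(1) edges_subset by blast
    then show ?thesis using e by (intro bexI[of _ p]) (auto simp: P_def)
  qed
  have "W = fst ` P \<union> snd ` P"
  proof
    show "W \<subseteq> fst ` P \<union> snd ` P" using cover by blast
    show "fst ` P \<union> snd ` P \<subseteq> W" using in_W by auto
  qed
  moreover have "fst ` P \<inter> snd ` P = {}" using P(1) disj by fastforce
  ultimately have cardW: "card W = 2 * card P"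
    using P(2) by (simp add: card_Un_disjoint card_image inj1 inj2)
  have "P \<noteq> {}" using W(2) cover by blast
  then obtain u v where "(u, v) \<in> P" by auto
  then have "{u, v} \<in> EW" using in_W[of u v] M(1) by (auto simp: P_def EW_def induced_def)
  moreover have finEW: "finite EW"
    using finite_edges[OF simple] by (simp add: EW_def induced_def)
  ultimately have m: "card EW > 0" by (auto simp: card_gt_0_iff)
  define conflict where
    "conflict p q \<longleftrightarrow> adj (fst p) (snd q) \<and> adj (fst q) (snd p)" for p q
  \<comment> \<open>Matching edges are determined by either end, so the edge \<open>{fst p, snd q}\<close> determines
    both \<open>p\<close> and \<open>q\<close>.\<close>
  have few: "card {(p, q). p \<in> P \<and> q \<in> P \<and> conflict p q} \<le> card EW"
  proof (rule card_inj_on_le[OF _ _ finEW])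
    let ?f = "\<lambda>(p, q). {fst p, snd q}"
    show "inj_on ?f {(p, q). p \<in> P \<and> q \<in> P \<and> conflict p q}"
    proof (rule inj_onI, clarify, rule conjI)
      fix u v x y u' v' x' y'
      assume in_P: "(u, v) \<in> P" "(x, y) \<in> P" "(u', v') \<in> P" "(x', y') \<in> P"
        and eq: "{fst (u, v), snd (x, y)} = {fst (u', v'), snd (x', y')}"
      then have "u = u'" "y = y'" using P(1) edge_eq_iff[of u y u' y'] by auto
      then show "(u, v) = (u', v')" "(x, y) = (x', y')"
        using in_P inj_onD[OF inj1, of "(u, v)" "(u', v')"] inj_onD[OF inj2, of "(x, y)" "(x', y')"]
        by auto
    qed
    show "?f ` {(p, q). p \<in> P \<and> q \<in> P \<and> conflict p q} \<subseteq> EW"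
      using in_W by (auto simp: EW_def induced_def conflict_def)
  qed
  have refl: "conflict p p" if "p \<in> P" for p
    using that M(1) by (auto simp: P_def conflict_def)
  have sym: "conflict q p" if "conflict p q" for p q
    using that by (simp add: conflict_def)
  obtain I where I: "I \<subseteq> P" "\<And>p q. p \<in> I \<Longrightarrow> q \<in> I \<Longrightarrow> conflict p q \<Longrightarrow> p = q"
      "(real (card P))\<^sup>2 / real (card EW) \<le> real (card I)"
    using large_independent_set[of P conflict, OF P(2) refl sym few m] by blast
  have "fooling_pairs adj I"
    using I(1,2) M(1) by (auto simp: fooling_pairs_def conflict_def P_def)
  then have "card I \<le> fool G" using I(1) P(1) by (intro card_le_fool) auto
  moreover have "real ((card (verts (induced G W)))\<^sup>2) / (4 * real (card EW))
      = (real (card P))\<^sup>2 / real (card EW)"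
    by (simp add: induced_def cardW power_mult_distrib)
  ultimately show ?thesis using I(3) by (simp add: EW_def)
qed

lemma jk_le_fool:
  assumes "bipartite_graph G U V"
  shows "jk G \<le> real (fool G)"
proof -
  let ?W = "{W. W \<subseteq> verts G \<and> W \<noteq> {} \<and> has_perfect_matching (induced G W)}"
  have "finite ?W"
    using assms by (auto simp: bipartite_graph_def simple_graph_def)
  then show ?thesis
    using perfect_matching_bound[OF assms] by (auto simp: jk_def Let_def)
qed

section \<open>Tensor powers\<close>

lemma finite_tuples: "finite S \<Longrightarrow> finite (tuples j S)"
  using finite_lists_length_eq[of S j] by (simp add: tuples_def conj_commute)

lemma card_tuples: "finite S \<Longrightarrow> card (tuples j S) = card S ^ j"
  using card_lists_length_eq[of S j] by (simp add: tuples_def conj_commute)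

lemma graph_of_matrix_edge_iff:
  "{Inl r, Inr c} \<in> edges (graph_of_matrix R C M) \<longleftrightarrow> r \<in> R \<and> c \<in> C \<and> M r c = 1"
  by (auto simp: graph_of_matrix_def doubleton_eq_iff)

lemma indexed_bipartite_graph_of_matrix:
  assumes "finite R" "finite C"
  shows "indexed_bipartite (graph_of_matrix R C M) Inl Inr R C"
proof
  show "bipartite_graph (graph_of_matrix R C M) (Inl ` R) (Inr ` C)"
    using assms
    by (auto simp: bipartite_graph_def simple_graph_def graph_of_matrix_def Plus_def)
qed auto

lemma tensor_power_eq_1_iff: "tensor_power j M us vs = 1 \<longleftrightarrow> (\<forall>i<j. M (us ! i) (vs ! i) = 1)"
  unfolding tensor_power_def by (subst prod_eq_1_iff) auto

text \<open>An entry of the tensor power is 1 only if all its factors are, so a single coordinate in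
  which two tuples of pairs differ keeps the tuples from being in conflict.\<close>

lemma fooling_pairs_tensor_power:
  assumes fool: "fooling_pairs (\<lambda>u v. M u v = 1) P"
  shows "fooling_pairs (\<lambda>us vs. tensor_power j M us vs = 1)
           ((\<lambda>ps. (map fst ps, map snd ps)) ` tuples j P)"
proof -
  have "(tensor_power j M (map fst ps) (map snd qs) = 1 \<and>
         tensor_power j M (map fst qs) (map snd ps) = 1) \<longleftrightarrow> ps = qs"
    if "ps \<in> tuples j P" "qs \<in> tuples j P" for ps qs
  proof -
    have len: "length ps = j" "length qs = j"
      using that by (auto simp: tuples_def)
    have P: "ps ! i \<in> P" "qs ! i \<in> P" if "i < j" for i
      using \<open>ps \<in> _\<close> \<open>qs \<in> _\<close> that nth_mem[of i ps] nth_mem[of i qs]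
      by (auto simp: tuples_def simp del: nth_mem)
    have "ps = qs \<longleftrightarrow> (\<forall>i<j. ps ! i = qs ! i)" using len by (simp add: list_eq_iff_nth_eq)
    also have "\<dots> \<longleftrightarrow> (\<forall>i<j. M (fst (ps ! i)) (snd (qs ! i)) = 1 \<and> M (fst (qs ! i)) (snd (ps ! i)) = 1)"
      using fool P unfolding fooling_pairs_def by blast
    finally show ?thesis using len unfolding tensor_power_eq_1_iff by auto
  qed
  moreover have "map fst ps = map fst qs \<and> map snd ps = map snd qs \<longleftrightarrow> ps = qs" for ps qs :: "('a \<times> 'b) list"
    by (metis zip_map_fst_snd)
  ultimately show ?thesis by (auto simp: fooling_pairs_def)
qed

lemma power_le_fool_tensor_power:
  assumes fin: "finite R" "finite C" and P: "P \<subseteq> R \<times> C" and fool: "fooling_pairs (\<lambda>u v. M u v = 1) P"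
  shows "card P ^ j \<le> fool (graph_of_matrix (tuples j R) (tuples j C) (tensor_power j M))"
    (is "_ \<le> fool ?G")
proof -
  interpret indexed_bipartite ?G Inl Inr "tuples j R" "tuples j C"
    using fin by (intro indexed_bipartite_graph_of_matrix finite_tuples)
  have "finite P" using P fin by (auto intro: finite_subset)
  define L where "L = (\<lambda>ps. (map fst ps, map snd ps)) ` tuples j P"
  have "inj (\<lambda>ps :: ('a \<times> 'b) list. (map fst ps, map snd ps))"
    by (rule injI) (metis prod.inject zip_map_fst_snd)
  then have card: "card L = card P ^ j"
    using \<open>finite P\<close> by (simp add: L_def card_tuples card_image inj_on_subset)
  have L: "L \<subseteq> tuples j R \<times> tuples j C"
    using P by (fastforce simp: L_def tuples_def)
  have "fooling_pairs (\<lambda>us vs. tensor_power j M us vs = 1) L"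
    unfolding L_def by (rule fooling_pairs_tensor_power[OF fool])
  then have "fooling_pairs adj L"
    using L unfolding fooling_pairs_def graph_of_matrix_edge_iff
    by (metis mem_Sigma_iff prod.collapse subsetD)
  then show ?thesis using card_le_fool[OF L] card by simp
qed

section \<open>The rank bound\<close>

lemma sum_apply:
  fixes f :: "'x \<Rightarrow> 'c \<Rightarrow> 'k::comm_monoid_add"
  shows "(\<Sum>x\<in>X. f x) c = (\<Sum>x\<in>X. f x c)"
  by (induction X rule: infinite_finite_induct) auto

text \<open>A diagonal matrix with nonzero diagonal has independent rows, and a factorization through
  \<open>T\<close> places these rows in the span of \<open>card T\<close> vectors.\<close>

lemma card_le_of_diagonal_factorization:
  fixes A B :: "'t \<Rightarrow> 'p \<Rightarrow> 'k::field"
  assumes P: "finite P" and T: "finite T"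
    and diag: "\<And>p q. p \<in> P \<Longrightarrow> q \<in> P \<Longrightarrow> (\<Sum>t\<in>T. A t p * B t q) \<noteq> 0 \<longleftrightarrow> p = q"
  shows "card P \<le> card T"
proof -
  interpret vs: vector_space "fun_scale :: 'k \<Rightarrow> ('p \<Rightarrow> 'k) \<Rightarrow> 'p \<Rightarrow> 'k"
    by (rule vector_space_fun_scale)
  define D where "D p = (\<Sum>t\<in>T. fun_scale (A t p) (B t))" for p
  have D: "D p q = (\<Sum>t\<in>T. A t p * B t q)" for p q
    by (simp add: D_def sum_apply fun_scale_def)
  have inj: "inj_on D P"
    by (rule inj_onI) (metis D diag)
  have "vs.independent (D ` P)"
  proof (rule vs.independent_if_scalars_zero)
    fix f d assume s: "(\<Sum>x\<in>D ` P. fun_scale (f x) x) = 0" and "d \<in> D ` P"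
    then obtain q where q: "q \<in> P" "d = D q" by blast
    have "0 = (\<Sum>x\<in>D ` P. fun_scale (f x) x) q" using s by simp
    also have "\<dots> = (\<Sum>p\<in>P. f (D p) * D p q)"
      by (simp add: sum_apply fun_scale_def sum.reindex[OF inj])
    also have "\<dots> = (\<Sum>p\<in>P. if p = q then f (D q) * D q q else 0)"
      using diag[OF _ q(1)] by (intro sum.cong) (auto simp: D)
    also have "\<dots> = f d * D q q" using P q by simp
    finally show "f d = 0" using diag[OF q(1) q(1)] by (simp add: D)
  qed (use P in simp)
  moreover have "D ` P \<subseteq> vs.span (B ` T)"
    unfolding D_def by (blast intro: vs.span_sum vs.span_scale vs.span_base)
  ultimately have "card (D ` P) \<le> card (B ` T)"
    using vs.independent_span_bound[of "B ` T" "D ` P"] T by simp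
  then show ?thesis using card_image[OF inj] card_image_le[OF T, of B] by simp
qed

text \<open>On a fooling set the products \<open>Q(u\<^sub>p, v\<^sub>q) Q(u\<^sub>q, v\<^sub>p)\<close> form a diagonal matrix
  indexed by \<open>p\<close> and \<open>q\<close>; expanding the product of the two sums factorizes it through
  \<open>T \<times> T\<close>.\<close>

lemma fooling_pairs_card_le_square:
  fixes a :: "'t \<Rightarrow> 'r \<Rightarrow> 'k::field" and b :: "'t \<Rightarrow> 'c \<Rightarrow> 'k"
  assumes P: "finite P" "P \<subseteq> R \<times> C" and fool: "fooling_pairs E P" and T: "finite T"
    and supp: "\<And>r c. r \<in> R \<Longrightarrow> c \<in> C \<Longrightarrow> (\<Sum>t\<in>T. a t r * b t c) \<noteq> 0 \<longleftrightarrow> E r c"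
  shows "card P \<le> (card T)\<^sup>2"
proof -
  define A where "A = (\<lambda>(s, t) p. a s (fst p) * b t (snd p))"
  define B where "B = (\<lambda>(s, t) q. b s (snd q) * a t (fst q))"
  have "card P \<le> card (T \<times> T)"
  proof (rule card_le_of_diagonal_factorization[OF P(1), where A = A and B = B])
    fix p q assume pq: "p \<in> P" "q \<in> P"
    have "(\<Sum>x\<in>T \<times> T. A x p * B x q) =
        (\<Sum>s\<in>T. a s (fst p) * b s (snd q)) * (\<Sum>t\<in>T. a t (fst q) * b t (snd p))"
      unfolding A_def B_def sum_product sum.cartesian_product
      by (intro sum.cong) (auto simp: algebra_simps)
    moreover have "fst p \<in> R" "fst q \<in> R" "snd p \<in> C" "snd q \<in> C" using pq P(2) by auto
    ultimately show "(\<Sum>x\<in>T \<times> T. A x p * B x q) \<noteq> 0 \<longleftrightarrow> p = q"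
      using fool pq supp unfolding fooling_pairs_def by simp
  qed (use T in simp)
  then show ?thesis by (simp add: card_cartesian_product power2_eq_square)
qed

text \<open>The index set is a basis of the row space itself, each basis row being its own column
  factor.\<close>

lemma rank_factorization:
  fixes Q :: "'r \<Rightarrow> 'c \<Rightarrow> 'k::field"
  assumes "finite R"
  obtains T :: "('c \<Rightarrow> 'k) set" and a where "finite T" "card T = matrix_rank R C Q"
    "\<And>r c. r \<in> R \<Longrightarrow> c \<in> C \<Longrightarrow> Q r c = (\<Sum>t\<in>T. a t r * t c)"
proof -
  interpret vs: vector_space "fun_scale :: 'k \<Rightarrow> ('c \<Rightarrow> 'k) \<Rightarrow> 'c \<Rightarrow> 'k"
    by (rule vector_space_fun_scale)
  define row where "row = (\<lambda>r c. if c \<in> C then Q r c else 0)"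
  obtain T where T: "T \<subseteq> row ` R" "row ` R \<subseteq> vs.span T" "card T = vs.dim (row ` R)"
    using vs.basis_exists by metis
  have "finite T" using T(1) assms finite_subset by blast
  have "\<exists>f. row r = (\<Sum>t\<in>T. fun_scale (f t) t)" if "r \<in> R" for r
    using that T(2) unfolding vs.span_finite[OF \<open>finite T\<close>] by blast
  then obtain f where f: "\<And>r. r \<in> R \<Longrightarrow> row r = (\<Sum>t\<in>T. fun_scale (f r t) t)" by metis
  show ?thesis
  proof (rule that[OF \<open>finite T\<close>])
    show "card T = matrix_rank R C Q" using T(3) by (simp add: matrix_rank_def row_def)
    fix r c assume "r \<in> R" "c \<in> C"
    then have "Q r c = row r c" by (simp add: row_def)
    also have "\<dots> = (\<Sum>t\<in>T. f r t * t c)"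
      by (subst f[OF \<open>r \<in> R\<close>]) (simp add: sum_apply fun_scale_def)
    finally show "Q r c = (\<Sum>t\<in>T. f r t * t c)" .
  qed
qed

text \<open>A product over \<open>j\<close> coordinates of sums over \<open>T\<close> expands into a sum over the functions from
  \<open>{..<j}\<close> to \<open>T\<close>, so the tensor power of \<open>Q\<close> factorizes through \<open>card T ^ j\<close> terms.\<close>

lemma fool_tensor_power_le:
  fixes Q :: "'r \<Rightarrow> 'c \<Rightarrow> 'k::field"
  assumes fin: "finite R" "finite C"
    and supp: "\<And>r c. r \<in> R \<Longrightarrow> c \<in> C \<Longrightarrow> Q r c \<noteq> 0 \<longleftrightarrow> M r c = 1"
  shows "fool (graph_of_matrix (tuples j R) (tuples j C) (tensor_power j M))
           \<le> ((matrix_rank R C Q)\<^sup>2) ^ j" (is "fool ?G \<le> _")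
proof -
  interpret indexed_bipartite ?G Inl Inr "tuples j R" "tuples j C"
    using fin by (intro indexed_bipartite_graph_of_matrix finite_tuples)
  obtain P where P: "P \<subseteq> tuples j R \<times> tuples j C" "finite P" "fooling_pairs adj P" "card P = fool ?G"
    by (rule fool_attained)
  obtain T a where T: "finite T" "card T = matrix_rank R C Q"
    and Q: "\<And>r c. r \<in> R \<Longrightarrow> c \<in> C \<Longrightarrow> Q r c = (\<Sum>t\<in>T. a t r * t c)"
    by (rule rank_factorization[OF fin(1), of C Q]) (use that in blast)
  define Tj where "Tj = ({..<j} \<rightarrow>\<^sub>E T)"
  have "card P \<le> (card Tj)\<^sup>2"
  proof (rule fooling_pairs_card_le_square[OF P(2,1,3)])
    show "finite Tj" using T(1) by (simp add: Tj_def finite_PiE)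
    fix us vs assume us: "us \<in> tuples j R" and vs: "vs \<in> tuples j C"
    have mem: "us ! i \<in> R" "vs ! i \<in> C" if "i < j" for i
      using that us vs by (auto simp: tuples_def subset_iff)
    have "(\<Sum>g\<in>Tj. (\<Prod>i<j. a (g i) (us ! i)) * (\<Prod>i<j. g i (vs ! i))) =
        (\<Prod>i<j. \<Sum>t\<in>T. a t (us ! i) * t (vs ! i))"
      using T(1) by (simp add: Tj_def prod_sum_PiE flip: prod.distrib)
    also have "\<dots> = (\<Prod>i<j. Q (us ! i) (vs ! i))"
      using Q mem by (intro prod.cong) auto
    finally show "(\<Sum>g\<in>Tj. (\<Prod>i<j. a (g i) (us ! i)) * (\<Prod>i<j. g i (vs ! i))) \<noteq> 0 \<longleftrightarrow> adj us vs"
      using supp mem us vs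
      unfolding graph_of_matrix_edge_iff tensor_power_eq_1_iff by auto
  qed
  also have "card Tj = matrix_rank R C Q ^ j"
    using T by (simp add: Tj_def card_PiE)
  finally show ?thesis using P(4) by (simp add: mult.commute flip: power_mult)
qed

section \<open>The chain of inequalities\<close>

lemma fool_le_fool_inf:
  assumes "bipartite_graph G U V"
  shows "ereal (real (fool G)) \<le> fool_inf G U V"
proof -
  interpret indexed_bipartite G "\<lambda>x. x" "\<lambda>x. x" U V
    by unfold_locales (use assms in auto)
  have fin: "finite U" "finite V"
    using assms by (auto simp: bipartite_graph_def simple_graph_def)
  obtain P where P: "P \<subseteq> U \<times> V" "fooling_pairs adj P" "card P = fool G"
    by (rule fool_attained)
  then have "fooling_pairs (\<lambda>u v. adj_matrix G u v = 1) P" by (simp add: adj_matrix_def)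
  from power_le_fool_tensor_power[OF fin P(1) this]
  have *: "fool G ^ j \<le> fool (graph_of_matrix (tuples j U) (tuples j V) (tensor_power j (adj_matrix G)))"
    for j using P(3) by simp
  show ?thesis
    unfolding fool_inf_def fool_inf_matrix_def
  proof (rule le_Limsup)
    show "\<forall>\<^sub>F j in sequentially. ereal (real (fool G)) \<le> ereal (root j (real (fool
        (graph_of_matrix (tuples j U) (tuples j V) (tensor_power j (adj_matrix G))))))"
      \<comment> \<open>\<open>root 0\<close> is constantly 0, so the term \<open>j = 0\<close> is left out.\<close>
      using eventually_gt_at_top[of 0]
    proof eventually_elim
      case (elim j)
      have "real (fool G) = root j (real (fool G ^ j))"
        using elim by (simp add: real_root_power_cancel)
      also have "\<dots> \<le> root j (real (fool
          (graph_of_matrix (tuples j U) (tuples j V) (tensor_power j (adj_matrix G)))))"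
        using elim * by (intro real_root_le_mono of_nat_mono)
      finally show ?case by simp
    qed
  qed simp
qed

lemma fool_inf_le_rank_square:
  fixes Q :: "'a \<Rightarrow> 'a \<Rightarrow> 'k::field"
  assumes G: "bipartite_graph G U V" and Q: "has_support_of Q G U V"
  shows "fool_inf G U V \<le> ereal (real ((matrix_rank U V Q)\<^sup>2))"
proof -
  have fin: "finite U" "finite V"
    using G by (auto simp: bipartite_graph_def simple_graph_def)
  have *: "fool (graph_of_matrix (tuples j U) (tuples j V) (tensor_power j (adj_matrix G)))
      \<le> ((matrix_rank U V Q)\<^sup>2) ^ j" for j
    using Q by (intro fool_tensor_power_le[OF fin]) (auto simp: has_support_of_def adj_matrix_def)
  show ?thesis
    unfolding fool_inf_def fool_inf_matrix_def
  proof (rule Limsup_bounded)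
    show "\<forall>\<^sub>F j in sequentially. ereal (root j (real (fool
        (graph_of_matrix (tuples j U) (tuples j V) (tensor_power j (adj_matrix G))))))
        \<le> ereal (real ((matrix_rank U V Q)\<^sup>2))"
      using eventually_gt_at_top[of 0]
    proof eventually_elim
      case (elim j)
      have "root j (real (fool
          (graph_of_matrix (tuples j U) (tuples j V) (tensor_power j (adj_matrix G)))))
          \<le> root j (real (((matrix_rank U V Q)\<^sup>2) ^ j))"
        using elim * by (intro real_root_le_mono of_nat_mono)
      also have "\<dots> = real ((matrix_rank U V Q)\<^sup>2)"
        unfolding of_nat_power[of _ j] by (rule real_root_power_cancel[OF elim]) simp
      finally show ?case by simp
    qed
  qed
qed

theorem mainTheorem1:
  fixes G :: "'a sgraph" and U V :: "'a set"
  assumes "bipartite_graph G U V"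
  shows "jk G \<le> real (fool G) \<and>
         ereal (real (fool G)) \<le> fool_inf G U V \<and>
         fool_inf G U V \<le>
           ereal (real (LEAST r. \<exists>Q :: 'a \<Rightarrow> 'a \<Rightarrow> 'k::field.
             has_support_of Q G U V \<and> r = (matrix_rank U V Q)\<^sup>2))"
proof (intro conjI jk_le_fool[OF assms] fool_le_fool_inf[OF assms])
  let ?ok = "\<lambda>r. \<exists>Q :: 'a \<Rightarrow> 'a \<Rightarrow> 'k. has_support_of Q G U V \<and> r = (matrix_rank U V Q)\<^sup>2"
  have "?ok (LEAST r. ?ok r)"
    by (rule LeastI_ex) (use has_support_of_adj_matrix in blast)
  then show "fool_inf G U V \<le> ereal (real (LEAST r. ?ok r))"
    using fool_inf_le_rank_square[OF assms] by metis
qed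

end
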